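(* Let $\gamma\in(0,1)$ and let $n$ be a fixed integer with $2\le n\le n^*(\gamma)$. Let $\mathbf{W}_1,\dots,\mathbf{W}_n$ be the complex Wishart matrices of the matrix model described in the context, with arithmetic mean $\mathbf{A}=\frac1n\sum_{i=1}^n\mathbf{W}_i$ and harmonic mean $\mathbf{H}=n\big(\sum_{i=1}^n\mathbf{W}_i^{-1}\big)^{-1}$. Let $\mathbf{\Sigma}=\mathbf{\Sigma}_P$ be a sequence of deterministic $P\times P$ positive definite matrices such that, almost surely, $$\limsup_{P,N\to\infty}\frac{\|\mathbf{\Sigma}\|\,\|\mathbf{\Sigma}^{-1}\|\,\|\mathbf{H}-\mathbf{I}\|}{\|\mathbf{A}-\mathbf{I}\|}<1.$$ Then $$\limsup_{P,N\to\infty}\frac{\|\mathbf{\Sigma}^{1/2}\mathbf{H}\mathbf{\Sigma}^{1/2}-\mathbf{\Sigma}\|}{\|\mathbf{\Sigma}^{1/2}\mathbf{A}\mathbf{\Sigma}^{1/2}-\mathbf{\Sigma}\|}<1\quad\text{almost surely.}$$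
   Context: Matrix model: $N=N(P)$ satisfies $\left|\frac{P}{N}-\gamma\right|\le \frac{K}{P^2}$, where $K>0$ and $\gamma\in(0,1)$ are constants not depending on $P$, $N$ or $n$. For each $P$, $\mathbf{X}_1,\dots,\mathbf{X}_n$ are independent $P\times N$ random matrices whose entries are i.i.d. standard complex Gaussians, i.e. distributed as $(Z_1+\sqrt{-1}\,Z_2)/\sqrt2$ with $Z_1,Z_2$ independent standard real Gaussians. Put $\mathbf{W}_i=N^{-1}\mathbf{X}_i\mathbf{X}_i^*$; for $P$ large one has $P<N$ and the $\mathbf{W}_i$ are almost surely invertible. All matrices for different $P$ live on a common probability space. $\mathbf{I}$ is the identity matrix, $\|\cdot\|$ the operator norm, and $\mathbf{\Sigma}^{1/2}$ the positive definite square root. Threshold: $n^*(\gamma)$ is the largest integer $m\ge2$ such that for all integers $n$ with $2\le n\le m$, $$\gamma-\frac{2\gamma}{n}+2\sqrt{\frac{\gamma}{n}}\sqrt{1-\gamma+\frac{\gamma}{n}}<\frac{\gamma}{n}+2\sqrt{\frac{\gamma}{n}}.$$ (The left side is the almost sure limit of $\|\mathbf{H}-\mathbf{I}\|$ and the right side is the almost sure limit of $\|\mathbf{A}-\mathbf{I}\|$.) *)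

theory Defs
  imports
    "HOL-Probability.Probability"
    "HOL-Real_Asymp.Real_Asymp"
    "Jordan_Normal_Form.Gauss_Jordan_Elimination"
    "Jordan_Normal_Form.Schur_Decomposition"
begin

definition vec_l2norm :: "complex vec \<Rightarrow> real" where
  "vec_l2norm v = sqrt (\<Sum>i<dim_vec v. (cmod (vec_index v i))\<^sup>2)"

definition op_norm :: "complex mat \<Rightarrow> real" where
  "op_norm A = (SUP v \<in> {v \<in> carrier_vec (dim_col A). vec_l2norm v \<le> 1}. vec_l2norm (A *\<^sub>v v))"

text \<open>A total inverse: singular matrices are sent to the zero matrix of the same dimension,
  as \<open>inverse 0 = 0\<close> in a field.\<close>
definition inv_mat :: "complex mat \<Rightarrow> complex mat" where
  "inv_mat A = (case mat_inverse A of Some B \<Rightarrow> B | None \<Rightarrow> 0\<^sub>m (dim_row A) (dim_col A))"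

text \<open>Here \<open>(A *\<^sub>v v) \<bullet>c v\<close> is the quadratic form of \<open>A\<close> at \<open>v\<close>; it is real when \<open>A\<close> is
  Hermitian.\<close>
definition pos_def_mat :: "nat \<Rightarrow> complex mat \<Rightarrow> bool" where
  "pos_def_mat p A \<longleftrightarrow> A \<in> carrier_mat p p \<and> mat_adjoint A = A \<and>
     (\<forall>v \<in> carrier_vec p. v \<noteq> 0\<^sub>v p \<longrightarrow> 0 < Re ((A *\<^sub>v v) \<bullet>c v))"

definition sqrt_mat :: "complex mat \<Rightarrow> complex mat" where
  "sqrt_mat A = (THE S. pos_def_mat (dim_row A) S \<and> S * S = A)"

text \<open>The sum of the \<open>p \<times> p\<close> matrices \<open>W 1, \<dots>, W n\<close>. Matrices of varying dimension do not form
  an instance of \<^class>\<open>comm_monoid_add\<close>, so the sum is taken entrywise.\<close>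
definition sum_mats :: "nat \<Rightarrow> nat \<Rightarrow> (nat \<Rightarrow> complex mat) \<Rightarrow> complex mat" where
  "sum_mats p n W = mat p p (\<lambda>jk. \<Sum>i=1..n. W i $$ jk)"

definition arith_mean :: "nat \<Rightarrow> nat \<Rightarrow> (nat \<Rightarrow> complex mat) \<Rightarrow> complex mat" where
  "arith_mean p n W = (1 / of_nat n) \<cdot>\<^sub>m sum_mats p n W"

definition harm_mean :: "nat \<Rightarrow> nat \<Rightarrow> (nat \<Rightarrow> complex mat) \<Rightarrow> complex mat" where
  "harm_mean p n W = of_nat n \<cdot>\<^sub>m inv_mat (sum_mats p n (\<lambda>i. inv_mat (W i)))"

definition std_complex_normal :: "complex measure" where
  "std_complex_normal =
     distr (density lborel (\<lambda>x. ennreal (std_normal_density x)) \<Otimes>\<^sub>M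
            density lborel (\<lambda>x. ennreal (std_normal_density x)))
       borel (\<lambda>(x, y). (complex_of_real x + \<i> * complex_of_real y) / complex_of_real (sqrt 2))"

text \<open>\<open>X 1, \<dots>, X n\<close> are independent random \<open>p \<times> q\<close> matrices with i.i.d. standard complex
  Gaussian entries; jointly this says that all \<open>n * p * q\<close> entries are mutually independent with
  that law.\<close>
definition complex_gaussian_matrices ::
    "'w measure \<Rightarrow> nat \<Rightarrow> nat \<Rightarrow> nat \<Rightarrow> (nat \<Rightarrow> 'w \<Rightarrow> complex mat) \<Rightarrow> bool" where
  "complex_gaussian_matrices M p q n X \<longleftrightarrow>
     (\<forall>i \<in> {1..n}. \<forall>\<omega> \<in> space M. X i \<omega> \<in> carrier_mat p q) \<and>
     prob_space.indep_vars M (\<lambda>_. borel) (\<lambda>(i, j, k) \<omega>. X i \<omega> $$ (j, k))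
       ({1..n} \<times> {..<p} \<times> {..<q}) \<and>
     (\<forall>i \<in> {1..n}. \<forall>j<p. \<forall>k<q. distr M borel (\<lambda>\<omega>. X i \<omega> $$ (j, k)) = std_complex_normal)"

definition wishart :: "complex mat \<Rightarrow> complex mat" where
  "wishart X = (1 / of_nat (dim_col X)) \<cdot>\<^sub>m (X * mat_adjoint X)"

definition threshold_ineq :: "real \<Rightarrow> nat \<Rightarrow> bool" where
  "threshold_ineq \<gamma> n \<longleftrightarrow>
     \<gamma> - 2 * \<gamma> / real n + 2 * sqrt (\<gamma> / real n) * sqrt (1 - \<gamma> + \<gamma> / real n)
       < \<gamma> / real n + 2 * sqrt (\<gamma> / real n)"

definition n_star :: "real \<Rightarrow> nat" where
  "n_star \<gamma> = (GREATEST m. 2 \<le> m \<and> (\<forall>n. 2 \<le> n \<and> n \<le> m \<longrightarrow> threshold_ineq \<gamma> n))"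

text \<open>The greatest element in the definition of \<^const>\<open>n_star\<close> exists.\<close>
lemma n_star:
  assumes "0 < \<gamma>" "\<gamma> < 1"
  shows "2 \<le> n_star \<gamma>" and "\<And>n. 2 \<le> n \<Longrightarrow> n \<le> n_star \<gamma> \<Longrightarrow> threshold_ineq \<gamma> n"
    and "\<not> threshold_ineq \<gamma> (Suc (n_star \<gamma>))"
proof -
  let ?Q = "\<lambda>m. 2 \<le> m \<and> (\<forall>n. 2 \<le> n \<and> n \<le> m \<longrightarrow> threshold_ineq \<gamma> n)"
  have "sqrt (1 - \<gamma> + \<gamma> / 2) < 1" using assms by simp
  then have "2 * sqrt (\<gamma> / 2) * sqrt (1 - \<gamma> + \<gamma> / 2) < 2 * sqrt (\<gamma> / 2) * 1"
    using assms by (intro mult_strict_left_mono) auto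
  moreover have "0 < \<gamma> / 2" using assms by simp
  ultimately have "2 * sqrt (\<gamma> / 2) * sqrt (1 - \<gamma> + \<gamma> / 2) < \<gamma> / 2 + 2 * sqrt (\<gamma> / 2)"
    by linarith
  then have "threshold_ineq \<gamma> 2"
    by (simp add: threshold_ineq_def)
  then have ex: "?Q 2" by (auto dest: le_antisym)
  have "((\<lambda>n. \<gamma> - 2 * \<gamma> / real n + 2 * sqrt (\<gamma> / real n) * sqrt (1 - \<gamma> + \<gamma> / real n)
      - (\<gamma> / real n + 2 * sqrt (\<gamma> / real n))) \<longlongrightarrow> \<gamma>) at_top"
    using assms by real_asymp
  then have "\<forall>\<^sub>F n in at_top. 0 < \<gamma> - 2 * \<gamma> / real n
      + 2 * sqrt (\<gamma> / real n) * sqrt (1 - \<gamma> + \<gamma> / real n) - (\<gamma> / real n + 2 * sqrt (\<gamma> / real n))"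
    using assms(1) by (rule order_tendstoD(1))
  then obtain b where b: "\<And>n. b \<le> n \<Longrightarrow> \<not> threshold_ineq \<gamma> n"
    unfolding eventually_sequentially threshold_ineq_def by force
  have bd: "\<And>m. ?Q m \<Longrightarrow> m \<le> b" using b by (meson nat_le_linear order_refl)
  have Q: "?Q (n_star \<gamma>)" unfolding n_star_def by (rule GreatestI_nat[where P = ?Q, OF ex]) (rule bd)
  then show "2 \<le> n_star \<gamma>" "\<And>n. 2 \<le> n \<Longrightarrow> n \<le> n_star \<gamma> \<Longrightarrow> threshold_ineq \<gamma> n" by auto
  show "\<not> threshold_ineq \<gamma> (Suc (n_star \<gamma>))"
  proof
    assume "threshold_ineq \<gamma> (Suc (n_star \<gamma>))"
    with Q have "?Q (Suc (n_star \<gamma>))" by (auto simp: le_Suc_eq)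
    then have "Suc (n_star \<gamma>) \<le> n_star \<gamma>"
      unfolding n_star_def by (rule Greatest_le_nat[where P = ?Q]) (rule bd)
    then show False by simp
  qed
qed

end

(* The bound is pointwise and deterministic. With S the positive definite square root of Sigma,
   S H S - Sigma = S (H - I) S and A - I = S^-1 (S A S - Sigma) S^-1. Since ||S||^2 <= ||Sigma||
   and ||S^-1||^2 <= ||Sigma^-1||, the ratio in the conclusion is at most the ratio in the
   hypothesis. Both ratios vanish together when A = I, by the convention x / 0 = 0. *)

theory Submission
  imports Defs "Jordan_Normal_Form.Spectral_Radius"
begin

text \<open>Submultiplicativity only produces the square of \<open>op_norm S\<close>; replacing it
  by \<open>op_norm (S * S)\<close> is one half of the C*-identity, available because
  \<open>S\<close> is Hermitian. The larger obstacle is that \<open>sqrt_mat\<close> is a definite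
  description, about which nothing is known before positive definite roots are shown to exist and to
  be unique. Both facts rest on unitary diagonalisation: existence takes roots of the eigenvalues,
  uniqueness inspects eigenvectors of the difference of two roots.\<close>

unbundle no vec_syntax

section \<open>Adjoints\<close>

lemma square_mult_carrier [simp, intro]:
  "A \<in> carrier_mat n n \<Longrightarrow> B \<in> carrier_mat n n \<Longrightarrow> A * B \<in> carrier_mat n n"
  by (rule mult_carrier_mat)

lemma mult_mat_zero_vec: "A \<in> carrier_mat m n \<Longrightarrow> A *\<^sub>v 0\<^sub>v n = 0\<^sub>v m"
  by (intro eq_vecI) auto

lemma square_mult_assoc:
  fixes A B C :: "'a :: semiring_0 mat"
  assumes "A \<in> carrier_mat n n" "B \<in> carrier_mat n n" "C \<in> carrier_mat n n"
  shows "A * B * C = A * (B * C)"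
  using assms by (rule assoc_mult_mat)

lemma mat_adjoint_dim [simp]:
  "dim_row (mat_adjoint A) = dim_col A" "dim_col (mat_adjoint A) = dim_row A"
  by (simp_all add: mat_adjoint_def mat_of_rows_def)

lemma mat_adjoint_carrier [simp, intro]:
  "A \<in> carrier_mat m n \<Longrightarrow> mat_adjoint A \<in> carrier_mat n m"
  by (rule carrier_matI) simp_all

lemma index_mat_adjoint [simp]:
  fixes A :: "complex mat"
  assumes "i < dim_col A" "j < dim_row A"
  shows "mat_adjoint A $$ (i, j) = cnj (A $$ (j, i))"
  using assms by (simp add: mat_adjoint_def mat_of_rows_def)

lemma mat_adjoint_adjoint [simp]: "mat_adjoint (mat_adjoint A) = A" for A :: "complex mat"
  by (rule eq_matI) auto

lemma mat_adjoint_mult: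
  fixes A B :: "complex mat"
  assumes "A \<in> carrier_mat m n" "B \<in> carrier_mat n k"
  shows "mat_adjoint (A * B) = mat_adjoint B * mat_adjoint A"
  using assms by (intro eq_matI) (auto simp: scalar_prod_def mult.commute)

lemma mat_adjoint_minus:
  fixes A B :: "complex mat"
  assumes "A \<in> carrier_mat m n" "B \<in> carrier_mat m n"
  shows "mat_adjoint (A - B) = mat_adjoint A - mat_adjoint B"
  using assms by (intro eq_matI) auto

lemma mat_adjoint_one [simp]: "mat_adjoint (1\<^sub>m n :: complex mat) = 1\<^sub>m n"
  by (rule eq_matI) auto

lemma cscalar_prod_adjoint:
  fixes A :: "complex mat"
  assumes A: "A \<in> carrier_mat m n" and "v \<in> carrier_vec n" "w \<in> carrier_vec m"
  shows "(A *\<^sub>v v) \<bullet>c w = v \<bullet>c (mat_adjoint A *\<^sub>v w)"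
proof -
  have "(A *\<^sub>v v) \<bullet>c w = (\<Sum>i<m. \<Sum>j<n. A $$ (i, j) * v $ j * cnj (w $ i))"
    using assms by (simp add: scalar_prod_def sum_distrib_right atLeast0LessThan)
  also have "\<dots> = (\<Sum>j<n. \<Sum>i<m. A $$ (i, j) * v $ j * cnj (w $ i))"
    by (rule sum.swap)
  also have "\<dots> = v \<bullet>c (mat_adjoint A *\<^sub>v w)"
    using assms
    by (auto simp: scalar_prod_def sum_distrib_left atLeast0LessThan mult_ac intro!: sum.cong)
  finally show ?thesis .
qed

section \<open>The Hermitian spectral theorem\<close>

text \<open>Only a left inverse is demanded; for square matrices it is two-sided, which
  \<open>unitary_mat_right\<close> supplies.\<close>

definition unitary_mat :: "nat \<Rightarrow> complex mat \<Rightarrow> bool" where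
  "unitary_mat n U \<longleftrightarrow> U \<in> carrier_mat n n \<and> mat_adjoint U * U = 1\<^sub>m n"

definition diag_matrix :: "nat \<Rightarrow> (nat \<Rightarrow> complex) \<Rightarrow> complex mat" where
  "diag_matrix n d = mat n n (\<lambda>(i, j). if i = j then d i else 0)"

lemma diag_matrix_carrier [simp, intro]: "diag_matrix n d \<in> carrier_mat n n"
  and diag_matrix_dim [simp]: "dim_row (diag_matrix n d) = n" "dim_col (diag_matrix n d) = n"
  and index_diag_matrix [simp]:
    "i < n \<Longrightarrow> j < n \<Longrightarrow> diag_matrix n d $$ (i, j) = (if i = j then d i else 0)"
  by (auto simp: diag_matrix_def)

lemma diag_matrix_mult: "diag_matrix n d * diag_matrix n e = diag_matrix n (\<lambda>i. d i * e i)"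
  by (rule eq_matI) (auto simp: scalar_prod_def if_distrib cong: if_cong)

lemma mat_adjoint_diag_matrix: "mat_adjoint (diag_matrix n d) = diag_matrix n (\<lambda>i. cnj (d i))"
  by (rule eq_matI) auto

lemma unitary_mat_carrier [simp]: "unitary_mat n U \<Longrightarrow> U \<in> carrier_mat n n"
  and unitary_mat_left: "unitary_mat n U \<Longrightarrow> mat_adjoint U * U = 1\<^sub>m n"
  by (simp_all add: unitary_mat_def)

lemma unitary_mat_right: "unitary_mat n U \<Longrightarrow> U * mat_adjoint U = 1\<^sub>m n"
  by (rule mat_mult_left_right_inverse) (auto simp: unitary_mat_def)

lemma unitary_mat_mult:
  assumes U: "unitary_mat n U" and V: "unitary_mat n V"
  shows "unitary_mat n (U * V)"
proof -
  note [simp] = unitary_mat_carrier[OF U] unitary_mat_carrier[OF V]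
  have "mat_adjoint (U * V) * (U * V) = mat_adjoint V * ((mat_adjoint U * U) * V)"
    by (simp add: mat_adjoint_mult[where m = n and n = n and k = n]
        square_mult_assoc[where n = n])
  then show ?thesis
    using U V by (simp add: unitary_mat_def left_mult_one_mat[of V n n])
qed

lemma block_diag_mult:
  fixes A A' D D' :: "'a :: semiring_0 mat"
  assumes A: "A \<in> carrier_mat k k" "A' \<in> carrier_mat k k"
    and D: "D \<in> carrier_mat m m" "D' \<in> carrier_mat m m"
  shows "four_block_mat A (0\<^sub>m k m) (0\<^sub>m m k) D * four_block_mat A' (0\<^sub>m k m) (0\<^sub>m m k) D'
    = four_block_mat (A * A') (0\<^sub>m k m) (0\<^sub>m m k) (D * D')"
proof -
  have "A * A' \<in> carrier_mat k k" "D * D' \<in> carrier_mat m m" using A D by auto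
  then show ?thesis
    using A D
    by (subst mult_four_block_mat[OF A(1) _ _ D(1) A(2) _ _ D(2)])
      (auto simp: left_mult_zero_mat[of _ k k] left_mult_zero_mat[of _ m k]
        right_mult_zero_mat[of _ k k] left_mult_zero_mat[of _ m m] right_mult_zero_mat[of _ m m])
qed

text \<open>Complete \<open>v\<close> to a basis and orthogonalise: Gram-Schmidt leaves the first
  vector alone, so normalising the family changes \<open>v\<close> by a scalar only. A multiple of
  \<open>v\<close> suffices, because the eigenvector equation is invariant under scaling.\<close>

lemma unitary_mat_with_first_column:
  assumes v: "v \<in> carrier_vec n" and v0: "v \<noteq> 0\<^sub>v n" and n: "0 < n"
  obtains U c where "unitary_mat n U" "col U 0 = c \<cdot>\<^sub>v v"
proof -
  interpret cof_vec_space n "TYPE(complex)" .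
  define b where "b = basis_completion v"
  note bc = basis_completion[OF v v0, folded b_def]
  define ws where "ws = gram_schmidt n b"
  note gs = gram_schmidt_result[OF bc(2,4,5) ws_def]
  have len: "length ws = n" using gs(4) bc(6) by simp
  have hd: "ws ! 0 = v"
  proof -
    have "b = v # tl b" using bc n by (cases b) auto
    then have "hd ws = v" unfolding ws_def using v by (metis gram_schmidt_hd)
    then show ?thesis using len n by (cases ws) auto
  qed
  have wc: "ws ! i \<in> carrier_vec n" if "i < n" for i
    using gs(3) len that by auto
  \<comment> \<open>Taken at \<open>i = j\<close>, the equivalence also says that no vector of the
    family is zero, which makes the length \<open>r i\<close> invertible below.\<close>
  have orth: "(ws ! i \<bullet>c ws ! j = 0) = (i \<noteq> j)" if "i < n" "j < n" for i j
    using corthogonalD[OF gs(2)] that len by auto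
  define r where "r i = complex_of_real (sqrt (Re (ws ! i \<bullet>c ws ! i)))" for i
  have r2: "ws ! i \<bullet>c ws ! i = r i * r i" and rr: "cnj (r i) = r i" and r0: "r i \<noteq> 0"
    if "i < n" for i
  proof -
    have ge: "ws ! i \<bullet>c ws ! i \<ge> 0" by (rule conjugate_square_ge_0_vec)
    then have "Re (ws ! i \<bullet>c ws ! i) \<ge> 0" "Im (ws ! i \<bullet>c ws ! i) = 0"
      by (auto simp: less_eq_complex_def)
    then show eq: "ws ! i \<bullet>c ws ! i = r i * r i"
      by (simp add: r_def complex_eq_iff)
    show "cnj (r i) = r i" by (simp add: r_def)
    show "r i \<noteq> 0" using orth[OF that that] eq by auto
  qed
  define U where "U = mat n n (\<lambda>(i, j). inverse (r j) * ws ! j $ i)"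
  have U: "U \<in> carrier_mat n n" by (simp add: U_def)
  have "mat_adjoint U * U = 1\<^sub>m n"
  proof (rule eq_matI)
    fix i j assume "i < dim_row (1\<^sub>m n :: complex mat)" "j < dim_col (1\<^sub>m n :: complex mat)"
    then have ij: "i < n" "j < n" by auto
    have "(mat_adjoint U * U) $$ (i, j)
        = (\<Sum>k<n. cnj (inverse (r i) * ws ! i $ k) * (inverse (r j) * ws ! j $ k))"
      using ij U by (auto simp: scalar_prod_def atLeast0LessThan U_def intro!: sum.cong)
    also have "\<dots> = inverse (r i) * inverse (r j) * (ws ! j \<bullet>c ws ! i)"
      using ij wc[OF ij(1)] wc[OF ij(2)]
      by (auto simp: scalar_prod_def atLeast0LessThan sum_distrib_left rr ac_simps
          intro!: sum.cong)
    also have "\<dots> = 1\<^sub>m n $$ (i, j)"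
      using ij orth[OF ij(2,1)] r2[OF ij(1)] r0[OF ij(1)] by (auto simp: field_simps)
    finally show "(mat_adjoint U * U) $$ (i, j) = 1\<^sub>m n $$ (i, j)" .
  qed (use U in auto)
  moreover have "col U 0 = inverse (r 0) \<cdot>\<^sub>v v"
    using n v U by (intro eq_vecI) (auto simp: U_def hd)
  ultimately show ?thesis using U that unfolding unitary_mat_def by blast
qed

lemma mat_adjoint_conjugation:
  fixes A U :: "complex mat"
  assumes "A \<in> carrier_mat n n" "U \<in> carrier_mat n n"
  shows "mat_adjoint (mat_adjoint U * A * U) = mat_adjoint U * mat_adjoint A * U"
  using assms
  by (simp add: mat_adjoint_mult[where m = n and n = n and k = n]
      square_mult_assoc[where n = n])

lemma unitary_conjugation_cancel:
  assumes A: "A \<in> carrier_mat n n" and U: "unitary_mat n U"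
  shows "U * (mat_adjoint U * A * U) * mat_adjoint U = A"
    and "mat_adjoint U * (U * A * mat_adjoint U) * U = A"
proof -
  note [simp] = A unitary_mat_carrier[OF U]
  have "U * (mat_adjoint U * A * U) * mat_adjoint U
      = (U * mat_adjoint U) * A * (U * mat_adjoint U)"
    by (simp add: square_mult_assoc[where n = n])
  then show "U * (mat_adjoint U * A * U) * mat_adjoint U = A"
    by (simp add: unitary_mat_right[OF U] left_mult_one_mat[OF A] right_mult_one_mat[OF A])
  have "mat_adjoint U * (U * A * mat_adjoint U) * U
      = (mat_adjoint U * U) * A * (mat_adjoint U * U)"
    by (simp add: square_mult_assoc[where n = n])
  then show "mat_adjoint U * (U * A * mat_adjoint U) * U = A"
    by (simp add: unitary_mat_left[OF U] left_mult_one_mat[OF A] right_mult_one_mat[OF A])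
qed

text \<open>Deflation: in positive dimension there is a complex eigenvector. Placing it in the first
  column of a unitary \<open>U\<close> splits off a 1 by 1 block and leaves a Hermitian block of
  size \<open>m\<close>, to which the induction applies. The \<open>d i\<close> stay complex here;
  their reality is derived in the proofs that use it.\<close>

theorem hermitian_spectral:
  assumes "A \<in> carrier_mat n n" "mat_adjoint A = A"
  obtains U d where "unitary_mat n U" "A = U * diag_matrix n d * mat_adjoint U"
proof -
  have "\<exists>U d. unitary_mat n U \<and> A = U * diag_matrix n d * mat_adjoint U"
    using assms
  proof (induction n arbitrary: A)
    case 0
    then show ?case
      by (intro exI[of _ "1\<^sub>m 0"] exI[of _ "\<lambda>_. 0"]) (auto simp: unitary_mat_def)
  next
    case (Suc m)
    note A = Suc.prems(1)
    obtain e where "eigenvalue A e"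
      using spectrum_non_empty[OF A] by (auto simp: spectrum_def)
    then obtain v where v: "v \<in> carrier_vec (Suc m)" "v \<noteq> 0\<^sub>v (Suc m)" and ev: "A *\<^sub>v v = e \<cdot>\<^sub>v v"
      using A by (auto simp: eigenvalue_def eigenvector_def)
    obtain U c where U: "unitary_mat (Suc m) U" and col: "col U 0 = c \<cdot>\<^sub>v v"
      using unitary_mat_with_first_column[OF v] by blast
    have Uc [simp]: "U \<in> carrier_mat (Suc m) (Suc m)" using U by simp
    have Acol: "A *\<^sub>v col U 0 = e \<cdot>\<^sub>v col U 0"
      unfolding col using A v ev by (simp add: mult_mat_vec smult_smult_assoc mult.commute)
    define B where "B = mat_adjoint U * A * U"
    have B: "B \<in> carrier_mat (Suc m) (Suc m)" unfolding B_def using A by simp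
    have Bh: "mat_adjoint B = B"
      unfolding B_def by (simp add: mat_adjoint_conjugation[OF A Uc] Suc.prems(2))
    \<comment> \<open>With \<open>u = col U 0\<close>, the first column of \<open>B\<close> is
      \<open>mat_adjoint U\<close> applied to \<open>A *\<^sub>v u\<close>, hence \<open>e\<close>
      times the first unit vector, by unitarity.\<close>
    have B0: "B $$ (i, 0) = (if i = 0 then e else 0)" if "i < Suc m" for i
    proof -
      have "B = mat_adjoint U * (A * U)"
        unfolding B_def using A by (simp add: square_mult_assoc[where n = "Suc m"])
      moreover have "col (A * U) 0 = A *\<^sub>v col U 0"
        by (rule col_mult2[OF A Uc]) simp
      ultimately have "B $$ (i, 0) = row (mat_adjoint U) i \<bullet> (A *\<^sub>v col U 0)"
        using that carrier_matD[OF A] carrier_matD[OF Uc] by simp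
      also have "\<dots> = e * (row (mat_adjoint U) i \<bullet> col U 0)"
        unfolding Acol using that Uc by (subst scalar_prod_smult_right) auto
      also have "row (mat_adjoint U) i \<bullet> col U 0 = (mat_adjoint U * U) $$ (i, 0)"
        using that carrier_matD[OF Uc] by simp
      finally show ?thesis using that by (simp add: unitary_mat_left[OF U])
    qed
    \<comment> \<open>Hermiticity turns the zeros of the first column into zeros of the first row.
      The corner entry is taken straight from \<open>B0\<close>, so \<open>e\<close> is never
      conjugated.\<close>
    have B0': "B $$ (0, j) = (if j = 0 then e else 0)" if "j < Suc m" for j
    proof (cases "j = 0")
      case False
      have "B $$ (0, j) = mat_adjoint B $$ (0, j)" by (simp add: Bh)
      also have "\<dots> = cnj (B $$ (j, 0))" using that B by (subst index_mat_adjoint) auto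
      finally show ?thesis using B0[OF that] False by simp
    qed (use B0[of 0] in simp)
    define C where "C = mat m m (\<lambda>(i, j). B $$ (Suc i, Suc j))"
    have C: "C \<in> carrier_mat m m" by (simp add: C_def)
    have "mat_adjoint C = C"
    proof (rule eq_matI)
      fix i j assume "i < dim_row C" "j < dim_col C"
      then have "i < m" "j < m" using C by auto
      then have "mat_adjoint C $$ (i, j) = mat_adjoint B $$ (Suc i, Suc j)"
        using B C by (subst (1 2) index_mat_adjoint) (auto simp: C_def)
      then show "mat_adjoint C $$ (i, j) = C $$ (i, j)"
        using \<open>i < m\<close> \<open>j < m\<close> by (simp add: Bh C_def)
    qed (use C in auto)
    from Suc.IH[OF C this] obtain V d
      where V: "unitary_mat m V" and Cd: "C = V * diag_matrix m d * mat_adjoint V" by blast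
    have Vc [simp]: "V \<in> carrier_mat m m" using V by simp
    \<comment> \<open>\<open>V\<close> diagonalises \<open>C\<close> alone; bordering it with a 1
      keeps the eigenvalue \<open>e\<close> in its corner, and \<open>U * W\<close> then
      diagonalises \<open>A\<close>.\<close>
    define W where "W = four_block_mat (1\<^sub>m 1) (0\<^sub>m 1 m) (0\<^sub>m m 1) V"
    have W: "W \<in> carrier_mat (Suc m) (Suc m)"
      using four_block_carrier_mat[of "1\<^sub>m 1 :: complex mat" 1 1 V m m] by (simp add: W_def)
    have Wa: "mat_adjoint W = four_block_mat (1\<^sub>m 1) (0\<^sub>m 1 m) (0\<^sub>m m 1) (mat_adjoint V)"
      using carrier_matD[OF Vc] by (intro eq_matI) (auto simp: W_def)
    have "mat_adjoint W * W = 1\<^sub>m (Suc m)"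
      unfolding Wa unfolding W_def
      by (simp add: block_diag_mult[of _ 1 _ _ m] unitary_mat_left[OF V] del: One_nat_def) simp
    then have Wu: "unitary_mat (Suc m) W" using W by (simp add: unitary_mat_def)
    have D: "diag_matrix (Suc m) (case_nat e d)
        = four_block_mat (diag_matrix 1 (\<lambda>_. e)) (0\<^sub>m 1 m) (0\<^sub>m m 1) (diag_matrix m d)"
      by (intro eq_matI) (auto split: nat.split)
    have Bb: "B = four_block_mat (diag_matrix 1 (\<lambda>_. e)) (0\<^sub>m 1 m) (0\<^sub>m m 1) C"
      using B C by (intro eq_matI) (auto simp: B0 B0' C_def)
    have BW: "B = W * diag_matrix (Suc m) (case_nat e d) * mat_adjoint W"
      unfolding D Wa unfolding W_def Bb Cd
      by (simp add: block_diag_mult[of _ 1 _ _ m] left_mult_one_mat[of _ 1 1]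
          right_mult_one_mat[of _ 1 1] del: One_nat_def)
    have "A = U * B * mat_adjoint U"
      using unitary_conjugation_cancel(1)[OF A U] by (simp add: B_def)
    also have "\<dots> = (U * W) * diag_matrix (Suc m) (case_nat e d) * mat_adjoint (U * W)"
      unfolding BW using W
      by (simp add: mat_adjoint_mult[where m = "Suc m" and n = "Suc m" and k = "Suc m"]
          square_mult_assoc[where n = "Suc m"])
    finally show ?case using unitary_mat_mult[OF U Wu] by blast
  qed
  then show ?thesis using that by blast
qed

section \<open>The Euclidean norm and the operator norm\<close>

lemma vec_l2norm_L2_set: "vec_l2norm v = L2_set (\<lambda>i. cmod (v $ i)) {..<dim_vec v}"
  by (simp add: vec_l2norm_def L2_set_def)

lemma vec_l2norm_nonneg [simp]: "0 \<le> vec_l2norm v"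
  by (simp add: vec_l2norm_L2_set)

lemma vec_l2norm_zero [simp]: "vec_l2norm (0\<^sub>v n) = 0"
  by (simp add: vec_l2norm_def)

lemma vec_l2norm_eq_0: "v \<in> carrier_vec n \<Longrightarrow> vec_l2norm v = 0 \<longleftrightarrow> v = 0\<^sub>v n"
  by (auto simp: vec_l2norm_L2_set L2_set_eq_0_iff intro!: eq_vecI)

lemma vec_l2norm_smult: "vec_l2norm (c \<cdot>\<^sub>v v) = cmod c * vec_l2norm v"
  by (auto simp: vec_l2norm_L2_set norm_mult L2_set_right_distrib intro!: L2_set_cong)

lemma cscalar_prod_self: "v \<bullet>c v = complex_of_real ((vec_l2norm v)\<^sup>2)"
proof -
  have "v \<bullet>c v = (\<Sum>i<dim_vec v. complex_of_real ((cmod (v $ i))\<^sup>2))"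
    by (auto simp: scalar_prod_def atLeast0LessThan complex_norm_square[symmetric] intro!: sum.cong)
  also have "\<dots> = complex_of_real ((vec_l2norm v)\<^sup>2)"
    by (simp add: vec_l2norm_def sum_nonneg)
  finally show ?thesis .
qed

lemma cscalar_prod_Cauchy_Schwarz:
  assumes "v \<in> carrier_vec n" "w \<in> carrier_vec n"
  shows "cmod (v \<bullet>c w) \<le> vec_l2norm v * vec_l2norm w"
proof -
  have "cmod (v \<bullet>c w) \<le> (\<Sum>i<n. cmod (v $ i) * cmod (w $ i))"
    using assms by (auto simp: scalar_prod_def atLeast0LessThan norm_mult intro!: sum_norm_le)
  also have "\<dots> \<le> vec_l2norm v * vec_l2norm w"
    using assms L2_set_mult_ineq[of "\<lambda>i. cmod (v $ i)" "\<lambda>i. cmod (w $ i)" "{..<n}"]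
    by (simp add: vec_l2norm_L2_set)
  finally show ?thesis .
qed

text \<open>Crude on purpose, since only finiteness of the operator norm is wanted: Cauchy-Schwarz
  against each row, with \<open>C\<close> the sum of the row norms.\<close>

lemma vec_l2norm_mult_mat_vec_bounded:
  assumes A: "A \<in> carrier_mat m n"
  shows "\<exists>C. \<forall>v \<in> carrier_vec n. vec_l2norm (A *\<^sub>v v) \<le> C * vec_l2norm v"
proof (intro exI ballI)
  fix v :: "complex vec" assume v: "v \<in> carrier_vec n"
  have "vec_l2norm (A *\<^sub>v v) \<le> (\<Sum>i<m. cmod ((A *\<^sub>v v) $ i))"
    using A L2_set_le_sum_abs[of "\<lambda>i. cmod ((A *\<^sub>v v) $ i)" "{..<m}"]
    by (simp add: vec_l2norm_L2_set)
  also have "\<dots> \<le> (\<Sum>i<m. vec_l2norm (conjugate (row A i)) * vec_l2norm v)"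
  proof (rule sum_mono)
    fix i assume "i \<in> {..<m}"
    then have r: "row A i \<in> carrier_vec n" and i: "i < dim_row A" using A by auto
    have "(A *\<^sub>v v) $ i = v \<bullet>c conjugate (row A i)"
      using r v i by (simp add: comm_scalar_prod[of _ n])
    then show "cmod ((A *\<^sub>v v) $ i) \<le> vec_l2norm (conjugate (row A i)) * vec_l2norm v"
      using cscalar_prod_Cauchy_Schwarz[OF v carrier_vec_conjugate[OF r]] by (simp add: mult.commute)
  qed
  finally show "vec_l2norm (A *\<^sub>v v)
      \<le> (\<Sum>i<m. vec_l2norm (conjugate (row A i))) * vec_l2norm v"
    by (simp add: sum_distrib_right)
qed

text \<open>A supremum of reals is guaranteed to be an upper bound only when the set is bounded
  above, so every lower estimate of \<open>op_norm\<close> passes through this fact.\<close>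

lemma op_norm_bdd_above:
  "bdd_above ((\<lambda>v. vec_l2norm (A *\<^sub>v v)) ` {v \<in> carrier_vec (dim_col A). vec_l2norm v \<le> 1})"
proof -
  obtain C where C: "\<And>v. v \<in> carrier_vec (dim_col A) \<Longrightarrow> vec_l2norm (A *\<^sub>v v) \<le> C * vec_l2norm v"
    using vec_l2norm_mult_mat_vec_bounded[of A "dim_row A" "dim_col A"] by auto
  \<comment> \<open>The sign of \<open>C\<close> is unknown (in dimension 0 any constant qualifies),
    hence the absolute value.\<close>
  have "vec_l2norm (A *\<^sub>v v) \<le> \<bar>C\<bar>" if "v \<in> carrier_vec (dim_col A)" "vec_l2norm v \<le> 1" for v
  proof -
    have "C * vec_l2norm v \<le> \<bar>C\<bar> * 1"
      using that(2) by (intro mult_mono) auto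
    then show ?thesis using C[OF that(1)] by linarith
  qed
  then show ?thesis by (intro bdd_aboveI[where M = "\<bar>C\<bar>"]) auto
qed

lemma op_norm_nonneg [simp]: "0 \<le> op_norm A"
proof -
  have "vec_l2norm (A *\<^sub>v 0\<^sub>v (dim_col A)) \<le> op_norm A"
    unfolding op_norm_def by (rule cSUP_upper) (use op_norm_bdd_above in auto)
  then show ?thesis using vec_l2norm_nonneg order_trans by blast
qed

lemma op_norm_leI:
  assumes A: "A \<in> carrier_mat m n" and c: "0 \<le> c"
    and le: "\<And>v. v \<in> carrier_vec n \<Longrightarrow> vec_l2norm (A *\<^sub>v v) \<le> c * vec_l2norm v"
  shows "op_norm A \<le> c"
  unfolding op_norm_def
proof (rule cSUP_least)
  show "{v \<in> carrier_vec (dim_col A). vec_l2norm v \<le> 1} \<noteq> {}"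
    by (auto intro!: exI[of _ "0\<^sub>v (dim_col A)"])
next
  fix v assume "v \<in> {v \<in> carrier_vec (dim_col A). vec_l2norm v \<le> 1}"
  then have v: "v \<in> carrier_vec n" "vec_l2norm v \<le> 1" using A by auto
  then show "vec_l2norm (A *\<^sub>v v) \<le> c"
    using le[OF v(1)] mult_left_mono[OF v(2) c] by linarith
qed

lemma vec_l2norm_mult_mat_vec_le:
  assumes A: "A \<in> carrier_mat m n" and v: "v \<in> carrier_vec n"
  shows "vec_l2norm (A *\<^sub>v v) \<le> op_norm A * vec_l2norm v"
proof (cases "vec_l2norm v = 0")
  case True
  then have "A *\<^sub>v v = 0\<^sub>v m" using A v by (simp add: vec_l2norm_eq_0 mult_mat_zero_vec)
  then show ?thesis by (simp add: True)
next
  case False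
  define c where "c = complex_of_real (inverse (vec_l2norm v))"
  have c: "cmod c = inverse (vec_l2norm v)" by (simp add: c_def norm_inverse)
  have "vec_l2norm (A *\<^sub>v (c \<cdot>\<^sub>v v)) \<le> op_norm A"
    unfolding op_norm_def using A v False
    by (intro cSUP_upper[OF _ op_norm_bdd_above]) (auto simp: vec_l2norm_smult c)
  moreover have "A *\<^sub>v (c \<cdot>\<^sub>v v) = c \<cdot>\<^sub>v (A *\<^sub>v v)" using A v by (rule mult_mat_vec)
  moreover have "0 < vec_l2norm v" using False vec_l2norm_nonneg[of v] by linarith
  ultimately show ?thesis by (simp add: vec_l2norm_smult c field_simps)
qed

lemma op_norm_mult:
  assumes A: "A \<in> carrier_mat m n" and B: "B \<in> carrier_mat n k"
  shows "op_norm (A * B) \<le> op_norm A * op_norm B"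
proof (rule op_norm_leI)
  show "A * B \<in> carrier_mat m k" using A B by (rule mult_carrier_mat)
next
  fix v :: "complex vec" assume v: "v \<in> carrier_vec k"
  have "vec_l2norm ((A * B) *\<^sub>v v) = vec_l2norm (A *\<^sub>v (B *\<^sub>v v))"
    using A B v by (simp add: assoc_mult_mat_vec)
  also have "\<dots> \<le> op_norm A * vec_l2norm (B *\<^sub>v v)"
    using A B v by (intro vec_l2norm_mult_mat_vec_le) auto
  also have "\<dots> \<le> op_norm A * (op_norm B * vec_l2norm v)"
    using B v by (intro mult_left_mono vec_l2norm_mult_mat_vec_le) auto
  finally show "vec_l2norm ((A * B) *\<^sub>v v) \<le> op_norm A * op_norm B * vec_l2norm v"
    by (simp add: mult.assoc)
qed simp

text \<open>For Hermitian \<open>S\<close> this is \<open>\<parallel>S v\<parallel>\<^sup>2 = \<langle>S\<^sup>2 v, v\<rangle>\<close> and the Cauchy-Schwarz inequality.\<close>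

lemma op_norm_hermitian_square:
  assumes S: "S \<in> carrier_mat n n" "mat_adjoint S = S"
  shows "(op_norm S)\<^sup>2 \<le> op_norm (S * S)"
proof -
  have "op_norm S \<le> sqrt (op_norm (S * S))"
  proof (rule op_norm_leI[OF S(1)])
    fix v :: "complex vec" assume v: "v \<in> carrier_vec n"
    have Sv: "S *\<^sub>v v \<in> carrier_vec n" and SSv: "(S * S) *\<^sub>v v \<in> carrier_vec n"
      using S v by auto
    have "(vec_l2norm (S *\<^sub>v v))\<^sup>2 = cmod ((S *\<^sub>v v) \<bullet>c (S *\<^sub>v v))"
      by (simp add: cscalar_prod_self norm_power)
    also have "(S *\<^sub>v v) \<bullet>c (S *\<^sub>v v) = (S *\<^sub>v (S *\<^sub>v v)) \<bullet>c v"
      using cscalar_prod_adjoint[OF S(1) Sv v] S(2) by simp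
    also have "S *\<^sub>v (S *\<^sub>v v) = (S * S) *\<^sub>v v"
      using S v by (simp add: assoc_mult_mat_vec)
    also have "cmod (((S * S) *\<^sub>v v) \<bullet>c v) \<le> vec_l2norm ((S * S) *\<^sub>v v) * vec_l2norm v"
      using SSv v by (rule cscalar_prod_Cauchy_Schwarz)
    also have "\<dots> \<le> (op_norm (S * S) * vec_l2norm v) * vec_l2norm v"
      using S v by (intro mult_right_mono vec_l2norm_mult_mat_vec_le) auto
    also have "\<dots> = (sqrt (op_norm (S * S)) * vec_l2norm v)\<^sup>2"
      by (simp add: power2_eq_square)
    finally show "vec_l2norm (S *\<^sub>v v) \<le> sqrt (op_norm (S * S)) * vec_l2norm v"
      by (rule power2_le_imp_le) simp
  qed simp
  then show ?thesis
    by (metis op_norm_nonneg power_mono real_sqrt_pow2)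
qed

section \<open>Square roots of positive definite matrices\<close>

lemma pos_def_matD:
  assumes "pos_def_mat p A"
  shows "A \<in> carrier_mat p p" "mat_adjoint A = A"
    and "v \<in> carrier_vec p \<Longrightarrow> v \<noteq> 0\<^sub>v p \<Longrightarrow> 0 < Re ((A *\<^sub>v v) \<bullet>c v)"
  using assms by (auto simp: pos_def_mat_def)

text \<open>A kernel vector would make the quadratic form vanish, so the determinant is nonzero and
  \<open>inv_mat\<close> returns a genuine inverse instead of its default zero matrix.\<close>

lemma pos_def_mat_inv:
  assumes "pos_def_mat p A"
  shows "inv_mat A \<in> carrier_mat p p" "inv_mat A * A = 1\<^sub>m p"
proof -
  note A = pos_def_matD[OF assms]
  have "det A \<noteq> 0"
  proof
    assume "det A = 0"
    then obtain v where v: "v \<in> carrier_vec p" "v \<noteq> 0\<^sub>v p" "A *\<^sub>v v = 0\<^sub>v p"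
      using det_0_iff_vec_prod_zero[OF A(1)] by blast
    then show False using A(3)[OF v(1,2)] by simp
  qed
  \<comment> \<open>Both facts speak of units of a matrix ring record; \<open>()\<close> fills its
    extension slot so that they match.\<close>
  then have "mat_inverse A \<noteq> None"
    using mat_inverse(1)[OF A(1), of "()"] det_non_zero_imp_unit[OF A(1), of "()"] by blast
  then obtain B where B: "mat_inverse A = Some B" by blast
  show "inv_mat A \<in> carrier_mat p p" "inv_mat A * A = 1\<^sub>m p"
    using mat_inverse(2)[OF A(1) B] B by (simp_all add: inv_mat_def)
qed

text \<open>Cancelling \<open>mat_adjoint U * U\<close> in \<open>A * U\<close> leaves
  \<open>U * diag_matrix n d\<close>; compare columns. As these are unit vectors, the last claim
  recovers \<open>d i\<close> as a value of the quadratic form, which is how positivity passes to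
  the eigenvalues.\<close>

lemma unitary_diagonal_column:
  assumes U: "unitary_mat n U" and A: "A = U * diag_matrix n d * mat_adjoint U" and i: "i < n"
  shows "A *\<^sub>v col U i = d i \<cdot>\<^sub>v col U i" "col U i \<in> carrier_vec n" "col U i \<noteq> 0\<^sub>v n"
    "(A *\<^sub>v col U i) \<bullet>c col U i = d i"
proof -
  note [simp] = unitary_mat_carrier[OF U]
  have Ac: "A \<in> carrier_mat n n" by (simp add: A)
  have dim [simp]: "dim_row U = n" "dim_col U = n" using carrier_matD[of U n n] by auto
  show c: "col U i \<in> carrier_vec n" by (intro carrier_vecI) simp
  have "A * U = U * diag_matrix n d * (mat_adjoint U * U)"
    by (simp add: A square_mult_assoc[where n = n])
  then have AU: "A * U = U * diag_matrix n d"
    by (simp add: unitary_mat_left[OF U] right_mult_one_mat[of _ n n])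
  have "A *\<^sub>v col U i = col (A * U) i"
    using col_mult2[OF Ac, of U n i] i by simp
  also have "\<dots> = d i \<cdot>\<^sub>v col U i"
    unfolding AU using i
    by (intro eq_vecI) (auto simp: scalar_prod_def if_distrib mult.commute cong: if_cong)
  finally show ev: "A *\<^sub>v col U i = d i \<cdot>\<^sub>v col U i" .
  have "col U i \<bullet>c col U i = (mat_adjoint U * U) $$ (i, i)"
    using i by (auto simp: scalar_prod_def mult.commute intro!: sum.cong)
  then have one: "col U i \<bullet>c col U i = 1" using i by (simp add: unitary_mat_left[OF U])
  then show "col U i \<noteq> 0\<^sub>v n" using c by (metis conjugate_square_eq_0_vec zero_neq_one)
  show "(A *\<^sub>v col U i) \<bullet>c col U i = d i" using c by (simp add: ev one)
qed

lemma pos_def_mat_sqrt_exists: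
  assumes "pos_def_mat p A"
  shows "\<exists>S. pos_def_mat p S \<and> S * S = A"
proof -
  note A = pos_def_matD[OF assms]
  obtain U d where U: "unitary_mat p U" and Ad: "A = U * diag_matrix p d * mat_adjoint U"
    using hermitian_spectral[OF A(1,2)] by blast
  note [simp] = unitary_mat_carrier[OF U] square_mult_assoc[where n = p]
  note col = unitary_diagonal_column[OF U Ad]
  define r where "r i = complex_of_real (sqrt (Re (d i)))" for i
  \<comment> \<open>Fourth roots of the eigenvalues: they present the candidate root as a Gram
    matrix \<open>mat_adjoint T * T\<close>, whose form at \<open>v\<close> is the squared length of
    \<open>T *\<^sub>v v\<close>.\<close>
  define q where "q i = complex_of_real (sqrt (sqrt (Re (d i))))" for i
  have d_pos: "0 < Re (d i)" if "i < p" for i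
    using A(3)[OF col(2,3)[OF that]] col(4)[OF that] by simp
  \<comment> \<open>Undoing the conjugation by \<open>U\<close> transfers hermiticity from
    \<open>A\<close> to its diagonal factor. So the \<open>d i\<close> are real; otherwise
    \<open>r i * r i\<close> would recover only \<open>Re (d i)\<close>.\<close>
  have "diag_matrix p (\<lambda>i. cnj (d i)) = diag_matrix p d"
    unfolding mat_adjoint_diag_matrix[symmetric]
  proof -
    have "mat_adjoint (mat_adjoint U * A * U) = mat_adjoint U * A * U"
      using mat_adjoint_conjugation[OF A(1), of U] A(2) by simp
    then show "mat_adjoint (diag_matrix p d) = diag_matrix p d"
      unfolding Ad using unitary_conjugation_cancel(2)[OF _ U, of "diag_matrix p d"] by simp
  qed
  then have "cnj (d i) = d i" if "i < p" for i
    using that by (metis index_diag_matrix)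
  then have "diag_matrix p (\<lambda>i. r i * r i) = diag_matrix p d"
    using d_pos by (intro eq_matI) (auto simp: r_def complex_eq_iff less_imp_le)
  then have rr: "diag_matrix p r * diag_matrix p r = diag_matrix p d"
    by (simp add: diag_matrix_mult)
  have "diag_matrix p (\<lambda>i. q i * q i) = diag_matrix p r"
    using d_pos by (intro eq_matI) (auto simp: q_def r_def complex_eq_iff less_imp_le)
  then have qq: "diag_matrix p q * diag_matrix p q = diag_matrix p r"
    by (simp add: diag_matrix_mult)
  have qa: "mat_adjoint (diag_matrix p q) = diag_matrix p q"
    unfolding mat_adjoint_diag_matrix by (intro eq_matI) (auto simp: q_def)
  define T where "T = diag_matrix p q * mat_adjoint U"
  define S where "S = mat_adjoint T * T"
  have T: "T \<in> carrier_mat p p" by (simp add: T_def)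
  have Ta: "mat_adjoint T = U * diag_matrix p q"
    unfolding T_def by (simp add: mat_adjoint_mult[of _ p p _ p] qa)
  have S: "S \<in> carrier_mat p p" using T by (simp add: S_def)
  have S_eq: "S = U * diag_matrix p r * mat_adjoint U"
  proof -
    have "S = U * (diag_matrix p q * diag_matrix p q) * mat_adjoint U"
      unfolding S_def Ta by (simp add: T_def)
    then show ?thesis by (simp add: qq)
  qed
  have "S * S = U * diag_matrix p r * (mat_adjoint U * U) * diag_matrix p r * mat_adjoint U"
    unfolding S_eq by simp
  also have "\<dots> = U * (diag_matrix p r * diag_matrix p r) * mat_adjoint U"
    unfolding unitary_mat_left[OF U] by (simp add: left_mult_one_mat[of _ p p])
  finally have SS: "S * S = A" by (simp add: rr Ad)
  have "pos_def_mat p S"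
    unfolding pos_def_mat_def
  proof (intro conjI ballI impI)
    show "mat_adjoint S = S"
      using T by (simp add: S_def mat_adjoint_mult[of _ p p _ p])
    fix v :: "complex vec" assume v: "v \<in> carrier_vec p" "v \<noteq> 0\<^sub>v p"
    have Tv: "T *\<^sub>v v \<in> carrier_vec p" using T v by simp
    have "(S *\<^sub>v v) \<bullet>c v = (mat_adjoint T *\<^sub>v (T *\<^sub>v v)) \<bullet>c v"
      using T v unfolding S_def by (simp add: assoc_mult_mat_vec[of _ p p _ p])
    also have "\<dots> = (T *\<^sub>v v) \<bullet>c (T *\<^sub>v v)"
      using cscalar_prod_adjoint[of "mat_adjoint T" p p "T *\<^sub>v v" v] T Tv v by simp
    finally have eq: "(S *\<^sub>v v) \<bullet>c v = complex_of_real ((vec_l2norm (T *\<^sub>v v))\<^sup>2)"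
      by (simp add: cscalar_prod_self)
    \<comment> \<open>If \<open>T\<close> annihilated \<open>v\<close>, then so would
      \<open>S\<close> and hence \<open>A = S * S\<close>, against the definiteness of
      \<open>A\<close>.\<close>
    have "T *\<^sub>v v \<noteq> 0\<^sub>v p"
    proof
      assume 0: "T *\<^sub>v v = 0\<^sub>v p"
      have "S *\<^sub>v v = mat_adjoint T *\<^sub>v (T *\<^sub>v v)"
        using T v unfolding S_def by (simp add: assoc_mult_mat_vec[of _ p p _ p])
      then have "S *\<^sub>v v = 0\<^sub>v p" using 0 T by (simp add: mult_mat_zero_vec[of _ p p])
      then have "A *\<^sub>v v = 0\<^sub>v p"
        using S v
        by (simp add: SS[symmetric] assoc_mult_mat_vec[of _ p p _ p] mult_mat_zero_vec[of _ p p])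
      then show False using A(3)[OF v] v by simp
    qed
    then have "vec_l2norm (T *\<^sub>v v) \<noteq> 0" using vec_l2norm_eq_0[OF Tv] by simp
    then show "0 < Re ((S *\<^sub>v v) \<bullet>c v)" by (simp add: eq)
  qed (rule S)
  with SS show ?thesis by blast
qed

text \<open>If \<open>S\<^sup>2 = T\<^sup>2\<close> then \<open>D = S - T\<close> satisfies \<open>S D + D T = 0\<close>; at an eigenvector \<open>D u = \<lambda> u\<close> this
  gives \<open>\<lambda> (\<langle>S u, u\<rangle> + \<langle>T u, u\<rangle>) = 0\<close>, so all eigenvalues of the Hermitian matrix \<open>D\<close> vanish.\<close>

lemma pos_def_mat_sqrt_unique:
  assumes "pos_def_mat p S" "pos_def_mat p T" and eq: "S * S = T * T"
  shows "S = T"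
proof -
  note S = pos_def_matD[OF assms(1)] and T = pos_def_matD[OF assms(2)]
  define D where "D = S - T"
  have D: "D \<in> carrier_mat p p" using S T by (simp add: D_def minus_carrier_mat)
  have Dh: "mat_adjoint D = D"
    unfolding D_def using mat_adjoint_minus[OF S(1) T(1)] S(2) T(2) by simp
  obtain U d where U: "unitary_mat p U" and Dd: "D = U * diag_matrix p d * mat_adjoint U"
    using hermitian_spectral[OF D Dh] by blast
  have "d i = 0" if i: "i < p" for i
  proof -
    define u where "u = col U i"
    note u = unitary_diagonal_column[OF U Dd i, folded u_def]
    have Su: "S *\<^sub>v u \<in> carrier_vec p" and Tu: "T *\<^sub>v u \<in> carrier_vec p" using S T u by auto
    have D_apply: "D *\<^sub>v w = S *\<^sub>v w - T *\<^sub>v w" if "w \<in> carrier_vec p" for w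
      unfolding D_def using S T that by (intro minus_mult_distrib_mat_vec)
    have SD: "S *\<^sub>v (D *\<^sub>v u) = S *\<^sub>v (S *\<^sub>v u) - S *\<^sub>v (T *\<^sub>v u)"
      unfolding D_apply[OF u(2)] using S Su Tu by (intro mult_minus_distrib_mat_vec)
    have DT: "D *\<^sub>v (T *\<^sub>v u) = S *\<^sub>v (T *\<^sub>v u) - T *\<^sub>v (T *\<^sub>v u)"
      by (rule D_apply[OF Tu])
    have "S *\<^sub>v (S *\<^sub>v u) = T *\<^sub>v (T *\<^sub>v u)"
      using eq S T u(2) by (metis assoc_mult_mat_vec)
    then have "S *\<^sub>v (D *\<^sub>v u) = - (D *\<^sub>v (T *\<^sub>v u))"
      unfolding SD DT using S T u by (intro eq_vecI) auto
    then have "(S *\<^sub>v (D *\<^sub>v u)) \<bullet>c u = - ((D *\<^sub>v (T *\<^sub>v u)) \<bullet>c u)"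
      using uminus_scalar_prod[OF mult_mat_vec_carrier[OF D Tu] carrier_vec_conjugate[OF u(2)]]
      by argo
    also have "(D *\<^sub>v (T *\<^sub>v u)) \<bullet>c u = (T *\<^sub>v u) \<bullet>c (D *\<^sub>v u)"
      using cscalar_prod_adjoint[OF D Tu u(2)] Dh by simp
    finally have "d i * ((S *\<^sub>v u) \<bullet>c u) = - (cnj (d i) * ((T *\<^sub>v u) \<bullet>c u))"
      unfolding u(1) using S Su Tu u(2)
      by (simp add: mult_mat_vec[OF S(1)] conjugate_smult_vec)
    \<comment> \<open>Moving \<open>D\<close> to the second slot of the inner product produced
      \<open>cnj (d i)\<close>; reality gives the two terms a common factor.\<close>
    moreover have "cnj (d i) = d i"
    proof -
      have "d i * (u \<bullet>c u) = cnj (d i) * (u \<bullet>c u)"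
        using cscalar_prod_adjoint[OF D u(2,2)] u(2) unfolding Dh u(1)
        by (simp add: conjugate_smult_vec)
      then show ?thesis using u(2,3) by (metis conjugate_square_eq_0_vec mult_right_cancel)
    qed
    ultimately have "d i * ((S *\<^sub>v u) \<bullet>c u + (T *\<^sub>v u) \<bullet>c u) = 0"
      by (simp add: algebra_simps)
    moreover have "0 < Re ((S *\<^sub>v u) \<bullet>c u + (T *\<^sub>v u) \<bullet>c u)"
      using S(3)[OF u(2,3)] T(3)[OF u(2,3)] by simp
    ultimately show ?thesis by (metis less_irrefl mult_eq_0_iff zero_complex.sel(1))
  qed
  then have "diag_matrix p d = 0\<^sub>m p p" by (intro eq_matI) auto
  then have "D = 0\<^sub>m p p"
    using unitary_mat_carrier[OF U] by (simp add: Dd right_mult_zero_mat[of _ p p] left_mult_zero_mat[of _ p p])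
  then show "S = T"
    using S(1) T(1) by (metis D_def minus_add_uminus_mat eq_matI carrier_matD index_minus_mat(1) index_zero_mat(1) right_minus_eq)
qed

text \<open>Existence and uniqueness give the description its intended value. Later proofs use
  nothing else about the root.\<close>

lemma sqrt_mat:
  assumes "pos_def_mat p A"
  shows "pos_def_mat p (sqrt_mat A)" "sqrt_mat A * sqrt_mat A = A"
proof -
  have dim: "dim_row A = p" using pos_def_matD(1)[OF assms] by simp
  have "\<exists>!S. pos_def_mat p S \<and> S * S = A"
    using pos_def_mat_sqrt_exists[OF assms] pos_def_mat_sqrt_unique by blast
  then have "pos_def_mat p (sqrt_mat A) \<and> sqrt_mat A * sqrt_mat A = A"
    unfolding sqrt_mat_def dim by (rule theI')
  then show "pos_def_mat p (sqrt_mat A)" "sqrt_mat A * sqrt_mat A = A" by auto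
qed

text \<open>\<open>R\<close> is the inverse of the root. Being Hermitian with square
  \<open>inv_mat A\<close> is all that the norm estimate asks of it, so it is not identified with
  the positive definite root of the inverse.\<close>

lemma inv_mat_hermitian_square:
  assumes A: "pos_def_mat p A"
  obtains R where "R \<in> carrier_mat p p" "mat_adjoint R = R" "R * R = inv_mat A"
    "R * sqrt_mat A = 1\<^sub>m p" "sqrt_mat A * R = 1\<^sub>m p"
proof -
  define S where "S = sqrt_mat A"
  note S = pos_def_matD[OF sqrt_mat(1)[OF A], folded S_def] and SS = sqrt_mat(2)[OF A, folded S_def]
  note R' = pos_def_mat_inv[OF sqrt_mat(1)[OF A], folded S_def]
  define R where "R = inv_mat S"
  have R [simp]: "R \<in> carrier_mat p p" and RS: "R * S = 1\<^sub>m p" using R' by (auto simp: R_def)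
  have [simp]: "S \<in> carrier_mat p p" by (rule S(1))
  have SR: "S * R = 1\<^sub>m p" by (rule mat_mult_left_right_inverse[OF R S(1) RS])
  note T = pos_def_mat_inv[OF A]
  \<comment> \<open>As \<open>S\<close> is Hermitian, taking adjoints exhibits
    \<open>mat_adjoint R\<close> as a left inverse of \<open>S\<close>, which must agree with the
    right inverse \<open>R\<close>.\<close>
  have "mat_adjoint (S * R) = 1\<^sub>m p" by (simp add: SR)
  then have aRS: "mat_adjoint R * S = 1\<^sub>m p"
    by (simp add: mat_adjoint_mult[of _ p p _ p] S(2))
  have "mat_adjoint R = mat_adjoint R * (S * R)"
    by (simp add: SR right_mult_one_mat[of _ p p])
  also have "\<dots> = mat_adjoint R * S * R" by (simp add: square_mult_assoc[where n = p])
  also have "\<dots> = R" by (simp add: aRS left_mult_one_mat[of _ p p])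
  finally have Rh: "mat_adjoint R = R" .
  have AR: "A * (R * R) = 1\<^sub>m p"
  proof -
    have "A * (R * R) = S * (S * R) * R"
      unfolding SS[symmetric] by (simp add: square_mult_assoc[where n = p])
    then show ?thesis by (simp add: SR right_mult_one_mat[of _ p p])
  qed
  have "R * R = inv_mat A * A * (R * R)"
    by (simp add: T(2) left_mult_one_mat[of _ p p])
  also have "\<dots> = inv_mat A * (A * (R * R))"
    using T(1) pos_def_matD(1)[OF A] by (simp add: square_mult_assoc[where n = p])
  also have "\<dots> = inv_mat A"
    unfolding AR using T(1) by (rule right_mult_one_mat)
  finally have RR: "R * R = inv_mat A" .
  show ?thesis by (rule that[OF R Rh RR RS[unfolded S_def] SR[unfolded S_def]])
qed

section \<open>Comparison of relative errors\<close>

text \<open>The bound is phrased through \<open>S * S\<close> because that product is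
  \<open>\<Sigma>\<close> for the root and \<open>inv_mat \<Sigma>\<close> for the inverse of the
  root.\<close>

lemma op_norm_sandwich_le:
  assumes S: "S \<in> carrier_mat p p" "mat_adjoint S = S" and B: "B \<in> carrier_mat p p"
  shows "op_norm (S * B * S) \<le> op_norm (S * S) * op_norm B"
proof -
  have "op_norm (S * B * S) \<le> op_norm (S * B) * op_norm S"
    using S B by (intro op_norm_mult[of _ p p _ p]) auto
  also have "\<dots> \<le> (op_norm S * op_norm B) * op_norm S"
    using S B by (intro mult_right_mono op_norm_mult[of _ p p _ p]) auto
  also have "\<dots> = (op_norm S)\<^sup>2 * op_norm B" by (simp add: power2_eq_square)
  also have "\<dots> \<le> op_norm (S * S) * op_norm B"
    using op_norm_hermitian_square[OF S] by (intro mult_right_mono) auto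
  finally show ?thesis .
qed

text \<open>\<open>B\<close> is arbitrary because the comparison takes the first bound at
  \<open>H\<close> for the numerator and the second at \<open>A\<close> for the denominator.\<close>

lemma sqrt_congruence_error:
  assumes "pos_def_mat p \<Sigma>" and B: "B \<in> carrier_mat p p"
  defines "S \<equiv> sqrt_mat \<Sigma>"
  shows "op_norm (S * B * S - \<Sigma>) \<le> op_norm \<Sigma> * op_norm (B - 1\<^sub>m p)"
    and "op_norm (B - 1\<^sub>m p) \<le> op_norm (inv_mat \<Sigma>) * op_norm (S * B * S - \<Sigma>)"
proof -
  note S = pos_def_matD(1,2)[OF sqrt_mat(1)[OF assms(1)], folded S_def]
    and SS = sqrt_mat(2)[OF assms(1), folded S_def]
  note [simp] = S(1) B square_mult_assoc[where n = p]
  have B1 [simp]: "B - 1\<^sub>m p \<in> carrier_mat p p" by (intro minus_carrier_mat) simp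
  have eq: "S * B * S - \<Sigma> = S * (B - 1\<^sub>m p) * S"
  proof -
    have "S * (B - 1\<^sub>m p) * S = (S * B - S * 1\<^sub>m p) * S"
      by (subst mult_minus_distrib_mat[OF S(1) B]) auto
    also have "\<dots> = (S * B - S) * S" using right_mult_one_mat[OF S(1)] by simp
    also have "\<dots> = S * B * S - S * S"
      by (rule minus_mult_distrib_mat[OF square_mult_carrier[OF S(1) B] S(1) S(1)])
    finally show ?thesis by (simp add: SS)
  qed
  show "op_norm (S * B * S - \<Sigma>) \<le> op_norm \<Sigma> * op_norm (B - 1\<^sub>m p)"
    unfolding eq using op_norm_sandwich_le[OF S B1] by (simp add: SS)
  obtain R where R: "R \<in> carrier_mat p p" "mat_adjoint R = R" "R * R = inv_mat \<Sigma>"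
    "R * S = 1\<^sub>m p" "S * R = 1\<^sub>m p"
    using inv_mat_hermitian_square[OF assms(1)] unfolding S_def by blast
  have "R * (S * (B - 1\<^sub>m p) * S) * R = (R * S) * (B - 1\<^sub>m p) * (S * R)"
    using R(1) by simp
  then have "R * (S * (B - 1\<^sub>m p) * S) * R = B - 1\<^sub>m p"
    unfolding R(4,5) left_mult_one_mat[OF B1] right_mult_one_mat[OF B1] .
  then show "op_norm (B - 1\<^sub>m p) \<le> op_norm (inv_mat \<Sigma>) * op_norm (S * B * S - \<Sigma>)"
    unfolding eq using op_norm_sandwich_le[OF R(1,2), of "S * (B - 1\<^sub>m p) * S"] R(3) by simp
qed

lemma sqrt_congruence_ratio_le:
  assumes \<Sigma>: "pos_def_mat p \<Sigma>" and H: "H \<in> carrier_mat p p" and A: "A \<in> carrier_mat p p"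
  defines "S \<equiv> sqrt_mat \<Sigma>"
  shows "op_norm (S * H * S - \<Sigma>) / op_norm (S * A * S - \<Sigma>)
    \<le> op_norm \<Sigma> * op_norm (inv_mat \<Sigma>) * op_norm (H - 1\<^sub>m p) / op_norm (A - 1\<^sub>m p)"
proof (cases "op_norm (S * A * S - \<Sigma>) = 0")
  case False
  define h a where "h = op_norm (S * H * S - \<Sigma>)" and "a = op_norm (S * A * S - \<Sigma>)"
  have h: "h \<le> op_norm \<Sigma> * op_norm (H - 1\<^sub>m p)"
    and a1: "a \<le> op_norm \<Sigma> * op_norm (A - 1\<^sub>m p)"
    and a2: "op_norm (A - 1\<^sub>m p) \<le> op_norm (inv_mat \<Sigma>) * a"
    using sqrt_congruence_error[OF \<Sigma>] H A by (auto simp: h_def a_def S_def)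
  have a: "0 < a" using False op_norm_nonneg unfolding a_def by (metis less_le)
  \<comment> \<open>A vanishing denominator on the right would collapse that side to 0 and could
    break the inequality. The first error bound at \<open>A\<close> excludes this once
    \<open>a\<close> is positive.\<close>
  then have b: "0 < op_norm (A - 1\<^sub>m p)" using a1 op_norm_nonneg by (metis less_le mult_zero_right not_le)
  have "h * op_norm (A - 1\<^sub>m p)
      \<le> (op_norm \<Sigma> * op_norm (H - 1\<^sub>m p)) * (op_norm (inv_mat \<Sigma>) * a)"
    using h a2 by (intro mult_mono) auto
  then show ?thesis
    unfolding h_def[symmetric] a_def[symmetric] using a b by (simp add: field_simps)
\<comment> \<open>In the remaining case the left quotient is 0 by the division convention, and the
  right one is nonnegative.\<close>
qed simp

lemma arith_mean_carrier [simp]: "arith_mean p n W \<in> carrier_mat p p"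
  by (simp add: arith_mean_def sum_mats_def)

text \<open>The default value at a singular matrix has the same dimensions. So
  \<open>harm_mean\<close> is well-formed at every sample point, and the comparison adds no
  exceptional null set.\<close>

lemma inv_mat_carrier: "A \<in> carrier_mat p p \<Longrightarrow> inv_mat A \<in> carrier_mat p p"
  by (auto simp: inv_mat_def dest: mat_inverse(2) split: option.split)

lemma harm_mean_carrier [simp]: "harm_mean p n W \<in> carrier_mat p p"
  unfolding harm_mean_def by (intro smult_carrier_mat inv_mat_carrier) (simp add: sum_mats_def)

theorem corollary2p1p1:
  fixes M :: "'w measure" and P N :: "nat \<Rightarrow> nat" and n :: nat and \<gamma> K :: real
    and X :: "nat \<Rightarrow> nat \<Rightarrow> 'w \<Rightarrow> complex mat"
    and \<Sigma> :: "nat \<Rightarrow> complex mat"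
  defines "W \<equiv> \<lambda>p i \<omega>. wishart (X p i \<omega>)"
  defines "A \<equiv> \<lambda>p \<omega>. arith_mean p n (\<lambda>i. W p i \<omega>)"
  defines "H \<equiv> \<lambda>p \<omega>. harm_mean p n (\<lambda>i. W p i \<omega>)"
  assumes "prob_space M"
    and "0 < \<gamma>" and "\<gamma> < 1" and "0 < K"
    and "2 \<le> n" and "n \<le> n_star \<gamma>"
    and "strict_mono P"
    and "\<And>k. 1 \<le> P k" and "\<And>k. 1 \<le> N (P k)"
    and "\<And>k. \<bar>real (P k) / real (N (P k)) - \<gamma>\<bar> \<le> K / (real (P k))\<^sup>2"
    and "\<And>k. complex_gaussian_matrices M (P k) (N (P k)) n (X (P k))"
    and "\<And>k. pos_def_mat (P k) (\<Sigma> (P k))"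
    and "AE \<omega> in M. limsup (\<lambda>k. ereal (
            op_norm (\<Sigma> (P k)) * op_norm (inv_mat (\<Sigma> (P k))) * op_norm (H (P k) \<omega> - 1\<^sub>m (P k))
              / op_norm (A (P k) \<omega> - 1\<^sub>m (P k)))) < 1"
  shows "AE \<omega> in M. limsup (\<lambda>k. ereal (
            op_norm (sqrt_mat (\<Sigma> (P k)) * H (P k) \<omega> * sqrt_mat (\<Sigma> (P k)) - \<Sigma> (P k))
              / op_norm (sqrt_mat (\<Sigma> (P k)) * A (P k) \<omega> * sqrt_mat (\<Sigma> (P k)) - \<Sigma> (P k)))) < 1"
proof -
  have le: "op_norm (sqrt_mat (\<Sigma> (P k)) * H (P k) \<omega> * sqrt_mat (\<Sigma> (P k)) - \<Sigma> (P k))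
      / op_norm (sqrt_mat (\<Sigma> (P k)) * A (P k) \<omega> * sqrt_mat (\<Sigma> (P k)) - \<Sigma> (P k))
    \<le> op_norm (\<Sigma> (P k)) * op_norm (inv_mat (\<Sigma> (P k))) * op_norm (H (P k) \<omega> - 1\<^sub>m (P k))
      / op_norm (A (P k) \<omega> - 1\<^sub>m (P k))" for k \<omega>
    by (rule sqrt_congruence_ratio_le) (use assms(15) in \<open>simp_all add: H_def A_def\<close>)
  \<comment> \<open>Since \<open>le\<close> holds for every \<open>k\<close> and \<omega>,
    monotonicity of the limit superior carries the strict bound over at each \<omega> where the
    hypothesis holds.\<close>
  show ?thesis
    using assms(16)
  proof eventually_elim
    case (elim \<omega>)
    show ?case
      by (rule le_less_trans[OF Limsup_mono elim]) (simp add: le)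
  qed
qed

end
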